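(* Let $\gamma_E\in(0,\frac1L]$, $\rho_E\in(0,1)$, and put $a_1=\frac{1-\rho_E}{\gamma_E}$, $a_2=\frac{\gamma_E^2}{1+\rho_E+\rho_E^2}$, $a_3=\frac{\gamma_E}{1+\rho_E}$. Consider the problem (P): minimize $E(\mathbf K,B)$ over real $\mathbf K=(K_0,\dots,K_N)\succ\mathbf 0$, $B>0$ subject to $T(\mathbf K,B)\le T_{\max}$ and $$\frac{a_1c_1}{(1-\rho_E^{K_0})\sum_{n\in\mathcal N}K_n}+\frac{a_2c_2(1-\rho_E^{3K_0})\max_{n\in\mathcal N}K_n^2}{1-\rho_E^{K_0}}+\frac{a_3(1-\rho_E^{2K_0})}{1-\rho_E^{K_0}}\left(\frac{c_3}{B}+\frac{c_4\sum_{n\in\mathcal N}q_{s_0,s_n}K_n^2}{\sum_{n\in\mathcal N}K_n}\right)\le C_{\max},$$ and the problem (P'): minimize $E(\mathbf K,B)$ over real $\mathbf K\succ\mathbf 0$, $B,T_1,T_2,X_0>0$ subject to $$\frac{C_n}{F_n}K_nT_1^{-1}\le1,\quad K_nT_2^{-1}\le1,\quad n\in\mathcal N,$$ $$\left(\frac{C_0}{F_0}+\max_{n\in\mathcal N}\frac{M_{s_n}}{r_n}+\frac{M_{s_0}}{r_0}+BT_1\right)\frac{K_0}{T_{\max}}\le1,$$ $$\frac{a_1c_1+\left(a_2c_2T_2^2+\frac{a_3c_3}{B}+C_{\max}X_0\right)\sum_{n\in\mathcal N}K_n+a_3c_4\sum_{n\in\mathcal N}q_{s_0,s_n}K_n^2}{\left(C_{\max}+a_2c_2T_2^2X_0^3+\frac{a_3c_3X_0^2}{B}\right)\sum_{n\in\mathcal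 N}K_n+a_3c_4X_0^2\sum_{n\in\mathcal N}q_{s_0,s_n}K_n^2}\le1,$$ $$X_0\ln\frac1{X_0}\le X_0K_0\ln\frac1{\rho_E},\quad K_0\ln\frac1{\rho_E}\le\ln\frac1{X_0},\quad X_0<1.$$ If $(\mathbf K^*,B^*,T_1^*,T_2^*,X_0^* )$ is an optimal point of (P'), then $(\mathbf K^*,B^* )$ is an optimal point of (P).
   Context: $N\in\mathbb Z_+$, $\mathcal N=\{1,\dots,N\}$, $\bar{\mathcal N}=\{0\}\cup\mathcal N$. All of the following are given positive real constants: $L$; $C_n,F_n,\alpha_n,p_n,r_n,M_{s_n}$ ($n\in\bar{\mathcal N}$); $q_{s_0,s_n}$ ($n\in\mathcal N$); $c_1,c_2,c_3,c_4$; $T_{\max},C_{\max}$. For $\mathbf K=(K_0,\dots,K_N)\succ\mathbf 0$ (componentwise positive) and $B>0$: $$T(\mathbf K,B)=K_0\left(B\max_{n\in\mathcal N}\frac{C_n}{F_n}K_n+\frac{C_0}{F_0}+\max_{n\in\mathcal N}\frac{M_{s_n}}{r_n}+\frac{M_{s_0}}{r_0}\right),$$ $$E(\mathbf K,B)=K_0\left(B\sum_{n\in\mathcal N}\alpha_nC_nF_n^2K_n+\alpha_0C_0F_0^2+\sum_{n\in\bar{\mathcal N}}\frac{p_nM_{s_n}}{r_n}\right).$$ An optimal point is a feasible point attaining the minimum (global optimum). *)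

theory Defs
  imports "HOL-Analysis.Analysis"
begin

text \<open>
  The given constants. In the indexed families, index 0 is \<open>s\<^sub>0\<close> and the indices
  \<open>1..N\<close> are the elements of \<open>\<N>\<close>; entries above \<open>N\<close> (and \<open>par_q S 0\<close>) are
  never used. \<open>par_M S n\<close> stands for \<open>M\<close> at \<open>s\<^sub>n\<close> and \<open>par_q S n\<close> for
  \<open>q\<close> at the pair \<open>(s\<^sub>0, s\<^sub>n)\<close>.
\<close>

record params =
  par_N :: nat
  par_L :: real
  par_C :: "nat \<Rightarrow> real"
  par_F :: "nat \<Rightarrow> real"
  par_alpha :: "nat \<Rightarrow> real"
  par_p :: "nat \<Rightarrow> real"
  par_r :: "nat \<Rightarrow> real"
  par_M :: "nat \<Rightarrow> real"
  par_q :: "nat \<Rightarrow> real"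
  par_c1 :: real
  par_c2 :: real
  par_c3 :: real
  par_c4 :: real
  par_Tmax :: real
  par_Cmax :: real

definition positive_params :: "params \<Rightarrow> bool" where
  "positive_params S \<longleftrightarrow>
     par_N S \<ge> 1 \<and> par_L S > 0 \<and>
     (\<forall>n\<in>{0..par_N S}. par_C S n > 0 \<and> par_F S n > 0 \<and> par_alpha S n > 0 \<and>
        par_p S n > 0 \<and> par_r S n > 0 \<and> par_M S n > 0) \<and>
     (\<forall>n\<in>{1..par_N S}. par_q S n > 0) \<and>
     par_c1 S > 0 \<and> par_c2 S > 0 \<and> par_c3 S > 0 \<and> par_c4 S > 0 \<and>
     par_Tmax S > 0 \<and> par_Cmax S > 0"

text \<open>
  The componentwise positive tuples \<open>(K\<^sub>0, \<dots>, K\<^sub>N)\<close>, as extensional functions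
  (undefined outside \<open>{0..N}\<close>), so that each tuple has exactly one representative.
\<close>

definition pos_tuples :: "params \<Rightarrow> (nat \<Rightarrow> real) set" where
  "pos_tuples S = ({0..par_N S} \<rightarrow>\<^sub>E {0<..})"

definition T_cost :: "params \<Rightarrow> (nat \<Rightarrow> real) \<Rightarrow> real \<Rightarrow> real" where
  "T_cost S K B = K 0 *
     (B * (MAX n\<in>{1..par_N S}. par_C S n / par_F S n * K n)
      + par_C S 0 / par_F S 0
      + (MAX n\<in>{1..par_N S}. par_M S n / par_r S n)
      + par_M S 0 / par_r S 0)"

definition E_cost :: "params \<Rightarrow> (nat \<Rightarrow> real) \<Rightarrow> real \<Rightarrow> real" where
  "E_cost S K B = K 0 *
     (B * (\<Sum>n\<in>{1..par_N S}. par_alpha S n * par_C S n * (par_F S n)\<^sup>2 * K n)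
      + par_alpha S 0 * par_C S 0 * (par_F S 0)\<^sup>2
      + (\<Sum>n\<in>{0..par_N S}. par_p S n * par_M S n / par_r S n))"

definition a1 :: "real \<Rightarrow> real \<Rightarrow> real" where
  "a1 \<gamma> \<rho> = (1 - \<rho>) / \<gamma>"

definition a2 :: "real \<Rightarrow> real \<Rightarrow> real" where
  "a2 \<gamma> \<rho> = \<gamma>\<^sup>2 / (1 + \<rho> + \<rho>\<^sup>2)"

definition a3 :: "real \<Rightarrow> real \<Rightarrow> real" where
  "a3 \<gamma> \<rho> = \<gamma> / (1 + \<rho>)"

definition C_error :: "params \<Rightarrow> real \<Rightarrow> real \<Rightarrow> (nat \<Rightarrow> real) \<Rightarrow> real \<Rightarrow> real" where
  "C_error S \<gamma> \<rho> K B =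
     a1 \<gamma> \<rho> * par_c1 S / ((1 - \<rho> powr K 0) * (\<Sum>n\<in>{1..par_N S}. K n))
     + a2 \<gamma> \<rho> * par_c2 S * (1 - \<rho> powr (3 * K 0)) * (MAX n\<in>{1..par_N S}. (K n)\<^sup>2)
         / (1 - \<rho> powr K 0)
     + a3 \<gamma> \<rho> * (1 - \<rho> powr (2 * K 0)) / (1 - \<rho> powr K 0)
         * (par_c3 S / B
            + par_c4 S * (\<Sum>n\<in>{1..par_N S}. par_q S n * (K n)\<^sup>2) / (\<Sum>n\<in>{1..par_N S}. K n))"

definition feasible_P :: "params \<Rightarrow> real \<Rightarrow> real \<Rightarrow> (nat \<Rightarrow> real) \<times> real \<Rightarrow> bool" where
  "feasible_P S \<gamma> \<rho> = (\<lambda>(K, B).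
     K \<in> pos_tuples S \<and> B > 0 \<and>
     T_cost S K B \<le> par_Tmax S \<and>
     C_error S \<gamma> \<rho> K B \<le> par_Cmax S)"

definition feasible_P' ::
  "params \<Rightarrow> real \<Rightarrow> real \<Rightarrow> (nat \<Rightarrow> real) \<times> real \<times> real \<times> real \<times> real \<Rightarrow> bool" where
  "feasible_P' S \<gamma> \<rho> = (\<lambda>(K, B, T1, T2, X0).
     K \<in> pos_tuples S \<and> B > 0 \<and> T1 > 0 \<and> T2 > 0 \<and> X0 > 0 \<and>
     (\<forall>n\<in>{1..par_N S}. par_C S n / par_F S n * K n * inverse T1 \<le> 1 \<and> K n * inverse T2 \<le> 1) \<and>
     (par_C S 0 / par_F S 0 + (MAX n\<in>{1..par_N S}. par_M S n / par_r S n)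
        + par_M S 0 / par_r S 0 + B * T1) * (K 0 / par_Tmax S) \<le> 1 \<and>
     (a1 \<gamma> \<rho> * par_c1 S
        + (a2 \<gamma> \<rho> * par_c2 S * T2\<^sup>2 + a3 \<gamma> \<rho> * par_c3 S / B + par_Cmax S * X0)
            * (\<Sum>n\<in>{1..par_N S}. K n)
        + a3 \<gamma> \<rho> * par_c4 S * (\<Sum>n\<in>{1..par_N S}. par_q S n * (K n)\<^sup>2))
     / ((par_Cmax S + a2 \<gamma> \<rho> * par_c2 S * T2\<^sup>2 * X0 ^ 3 + a3 \<gamma> \<rho> * par_c3 S * X0\<^sup>2 / B)
            * (\<Sum>n\<in>{1..par_N S}. K n)
        + a3 \<gamma> \<rho> * par_c4 S * X0\<^sup>2 * (\<Sum>n\<in>{1..par_N S}. par_q S n * (K n)\<^sup>2)) \<le> 1 \<and>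
     X0 * ln (1 / X0) \<le> X0 * K 0 * ln (1 / \<rho>) \<and>
     K 0 * ln (1 / \<rho>) \<le> ln (1 / X0) \<and>
     X0 < 1)"

definition optimal_P :: "params \<Rightarrow> real \<Rightarrow> real \<Rightarrow> (nat \<Rightarrow> real) \<times> real \<Rightarrow> bool" where
  "optimal_P S \<gamma> \<rho> = is_arg_min (\<lambda>(K, B). E_cost S K B) (feasible_P S \<gamma> \<rho>)"

definition optimal_P' ::
  "params \<Rightarrow> real \<Rightarrow> real \<Rightarrow> (nat \<Rightarrow> real) \<times> real \<times> real \<times> real \<times> real \<Rightarrow> bool" where
  "optimal_P' S \<gamma> \<rho> = is_arg_min (\<lambda>(K, B, T1, T2, X0). E_cost S K B) (feasible_P' S \<gamma> \<rho>)"

end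

theory Submission
  imports Defs
begin

text \<open>
  The two logarithmic constraints force \<open>X0 = \<rho> powr K 0\<close>. Clearing denominators, the ratio
  constraint then becomes the error constraint of (P) with \<open>(MAX n. (K n)\<^sup>2)\<close> replaced by
  \<open>T2\<^sup>2\<close>, and similarly \<open>T1\<close> replaces the maximum in the time constraint. As both
  constraints are monotone in \<open>T1\<close> and \<open>T2\<close>, the feasible set of (P) is exactly the
  projection of that of (P'), and the objective does not depend on the eliminated variables.
\<close>

text \<open>Cancelling \<open>x > 0\<close> in the first inequality leaves the reverse of the
  second, so together they state \<open>ln x = k * ln \<rho>\<close>.\<close>

lemma log_constraints_iff_eq_powr:
  fixes x k \<rho> :: real
  assumes "0 < x" "0 < \<rho>"
  shows "(x * ln (1 / x) \<le> x * k * ln (1 / \<rho>) \<and> k * ln (1 / \<rho>) \<le> ln (1 / x)) \<longleftrightarrow>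
    x = \<rho> powr k" (is "?L \<longleftrightarrow> _")
proof -
  have "?L \<longleftrightarrow> ln x = k * ln \<rho>"
    using assms by (auto simp: ln_div mult.assoc)
  also have "\<dots> \<longleftrightarrow> x = \<rho> powr k"
    using assms by (metis exp_ln ln_powr powr_gt_zero less_irrefl)
  finally show ?thesis .
qed

text \<open>With \<open>?d > 0\<close> and \<open>(1 - X) * s > 0\<close>, everything rests on the
  identity \<open>?d - ?n = (c - ?e) * ((1 - X) * s)\<close>.\<close>

lemma ratio_constraint_iff:
  fixes A u v w c X s :: real
  assumes "0 < X" "X < 1" "0 < s" "0 < c" "0 \<le> u" "0 \<le> v" "0 \<le> w"
  shows "(A + (u + v + c * X) * s + w) / ((c + u * X ^ 3 + v * X\<^sup>2) * s + X\<^sup>2 * w) \<le> 1 \<longleftrightarrow>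
    A / ((1 - X) * s) + u * (1 - X ^ 3) / (1 - X) + (1 - X\<^sup>2) / (1 - X) * (v + w / s) \<le> c"
    (is "?n / ?d \<le> 1 \<longleftrightarrow> ?e \<le> c")
proof -
  have "0 < ?d"
    using assms by (intro add_pos_nonneg mult_pos_pos mult_nonneg_nonneg) auto
  then have "?n / ?d \<le> 1 \<longleftrightarrow> ?n \<le> ?d"
    by simp
  also have "\<dots> \<longleftrightarrow> ?e * ((1 - X) * s) \<le> c * ((1 - X) * s)"
  proof -
    \<comment> \<open>The differences \<open>1 - X\<close>, \<open>1 - X ^ 3\<close> and
      \<open>1 - X\<^sup>2\<close> are generalised to atoms \<open>d\<close>, \<open>p\<close>,
      \<open>q\<close>, so that \<open>field_simps\<close> clears denominators without expanding
      them.\<close>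
    have "(A / (d * s) + u * p / d + q / d * (v + w / s)) * (d * s) = A + u * p * s + q * (v * s + w)"
      if "d \<noteq> 0" for d p q :: real
      using that assms by (simp add: field_simps)
    from this[of "1 - X"]
    have "?e * ((1 - X) * s) = A + u * (1 - X ^ 3) * s + (1 - X\<^sup>2) * (v * s + w)"
      using assms by simp
    show ?thesis
      unfolding \<open>?e * ((1 - X) * s) = _\<close> by (simp add: algebra_simps)
  qed
  also have "\<dots> \<longleftrightarrow> ?e \<le> c"
    using assms by simp
  finally show ?thesis .
qed

text \<open>Squaring is monotone on nonnegative reals, so both maxima are attained at the same
  index. This links the maximum of squares in (P) to the bound \<open>T2\<close> on the
  \<open>K n\<close> themselves.\<close>

lemma Max_image_power2:
  fixes f :: "'a \<Rightarrow> real"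
  assumes "finite A" "A \<noteq> {}" "\<And>n. n \<in> A \<Longrightarrow> 0 \<le> f n"
  shows "(MAX n\<in>A. (f n)\<^sup>2) = (MAX n\<in>A. f n)\<^sup>2"
proof (rule Max_eqI)
  fix y assume "y \<in> (\<lambda>n. (f n)\<^sup>2) ` A"
  then show "y \<le> (MAX n\<in>A. f n)\<^sup>2"
    using assms by (auto intro!: power_mono)
next
  have "(MAX n\<in>A. f n) \<in> f ` A"
    using assms by (intro Max_in) auto
  then show "(MAX n\<in>A. f n)\<^sup>2 \<in> (\<lambda>n. (f n)\<^sup>2) ` A"
    by auto
qed (use assms in auto)

context
  fixes S :: params and \<gamma> \<rho> :: real and K :: "nat \<Rightarrow> real" and B :: real
  assumes S: "positive_params S" and \<gamma>: "0 < \<gamma>" and \<rho>: "0 < \<rho>" "\<rho> < 1"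
    and K: "K \<in> pos_tuples S" and B: "0 < B"
begin

lemma K_pos: "n \<le> par_N S \<Longrightarrow> 0 < K n"
  using K by (auto simp: pos_tuples_def PiE_def Pi_def)

text \<open>The time constraint of (P') as a function of \<open>T1\<close> alone; at the true
  maximum it equals \<open>T_cost\<close> divided by \<open>par_Tmax S\<close>.\<close>

definition relaxed_T :: "real \<Rightarrow> real" where
  "relaxed_T T1 = (par_C S 0 / par_F S 0 + (MAX n\<in>{1..par_N S}. par_M S n / par_r S n)
     + par_M S 0 / par_r S 0 + B * T1) * (K 0 / par_Tmax S)"

text \<open>The error term with a free \<open>m\<close> in place of the maximum of the
  \<open>K n\<close>. It is arranged to match the right side of \<open>ratio_constraint_iff\<close>
  at \<open>X = \<rho> powr K 0\<close>, with \<open>a3\<close> moved inside the bracket.\<close>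

definition relaxed_C :: "real \<Rightarrow> real" where
  "relaxed_C m =
     a1 \<gamma> \<rho> * par_c1 S / ((1 - \<rho> powr K 0) * (\<Sum>n\<in>{1..par_N S}. K n))
     + a2 \<gamma> \<rho> * par_c2 S * m\<^sup>2 * (1 - (\<rho> powr K 0) ^ 3) / (1 - \<rho> powr K 0)
     + (1 - (\<rho> powr K 0)\<^sup>2) / (1 - \<rho> powr K 0)
         * (a3 \<gamma> \<rho> * par_c3 S / B
            + a3 \<gamma> \<rho> * par_c4 S * (\<Sum>n\<in>{1..par_N S}. par_q S n * (K n)\<^sup>2)
                / (\<Sum>n\<in>{1..par_N S}. K n))"

lemma powr_less_one: "\<rho> powr K 0 < 1"
  using powr_less_mono2[of "K 0" \<rho> 1] \<rho> K_pos[of 0] by simp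

lemma coefficients_pos: "0 < a2 \<gamma> \<rho>" "0 < a3 \<gamma> \<rho>"
  using \<gamma> \<rho> by (simp_all add: a2_def a3_def add_pos_pos)

lemma relaxed_T_mono: "x \<le> y \<Longrightarrow> relaxed_T x \<le> relaxed_T y"
  unfolding relaxed_T_def using S B K_pos[of 0]
  by (intro mult_right_mono add_left_mono mult_left_mono) (auto simp: positive_params_def)

text \<open>Only the middle summand depends on \<open>m\<close>, through \<open>m\<^sup>2\<close>
  with a nonnegative coefficient.\<close>

lemma relaxed_C_mono:
  assumes "0 \<le> x" "x \<le> y"
  shows "relaxed_C x \<le> relaxed_C y"
proof -
  have "(\<rho> powr K 0) ^ 3 \<le> 1"
    using powr_less_one by (simp add: power_le_one)
  then show ?thesis
    using assms S powr_less_one coefficients_pos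
    by (auto simp: relaxed_C_def positive_params_def
        intro!: divide_right_mono mult_right_mono mult_left_mono power_mono)
qed

lemma T_cost_le_iff:
  "T_cost S K B \<le> par_Tmax S \<longleftrightarrow>
     relaxed_T (MAX n\<in>{1..par_N S}. par_C S n / par_F S n * K n) \<le> 1"
proof -
  have "relaxed_T (MAX n\<in>{1..par_N S}. par_C S n / par_F S n * K n) = T_cost S K B / par_Tmax S"
    by (simp add: T_cost_def relaxed_T_def ac_simps)
  then show ?thesis
    using S by (simp add: positive_params_def)
qed

lemma C_error_eq: "C_error S \<gamma> \<rho> K B = relaxed_C (MAX n\<in>{1..par_N S}. K n)"
proof -
  have "(MAX n\<in>{1..par_N S}. (K n)\<^sup>2) = (MAX n\<in>{1..par_N S}. K n)\<^sup>2"
    using S K_pos by (intro Max_image_power2) (auto simp: positive_params_def less_imp_le)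
  moreover have "\<rho> powr (3 * K 0) = (\<rho> powr K 0) ^ 3" "\<rho> powr (2 * K 0) = (\<rho> powr K 0)\<^sup>2"
    using \<rho> by (simp_all add: powr_power mult.commute)
  ultimately show ?thesis
    unfolding C_error_def relaxed_C_def by (simp add: distrib_left mult.commute mult.left_commute)
qed

lemma feasible_P'_iff:
  "feasible_P' S \<gamma> \<rho> (K, B, T1, T2, X0) \<longleftrightarrow>
     (MAX n\<in>{1..par_N S}. par_C S n / par_F S n * K n) \<le> T1 \<and> (MAX n\<in>{1..par_N S}. K n) \<le> T2 \<and>
     0 < T1 \<and> 0 < T2 \<and> X0 = \<rho> powr K 0 \<and> relaxed_T T1 \<le> 1 \<and> relaxed_C T2 \<le> par_Cmax S"
proof -
  have N: "{1..par_N S} \<noteq> {}"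
    using S by (simp add: positive_params_def)
  have s: "0 < (\<Sum>n\<in>{1..par_N S}. K n)"
    using N K_pos by (intro sum_pos) auto
  have q: "0 \<le> (\<Sum>n\<in>{1..par_N S}. par_q S n * (K n)\<^sup>2)"
    using S by (intro sum_nonneg) (auto simp: positive_params_def less_imp_le)
  have maxima: "(\<forall>n\<in>{1..par_N S}. par_C S n / par_F S n * K n * inverse T1 \<le> 1 \<and> K n * inverse T2 \<le> 1)
      \<longleftrightarrow> (MAX n\<in>{1..par_N S}. par_C S n / par_F S n * K n) \<le> T1 \<and> (MAX n\<in>{1..par_N S}. K n) \<le> T2"
    if "0 < T1" "0 < T2"
  proof -
    have "x * inverse t \<le> 1 \<longleftrightarrow> x \<le> t" if "0 < t" for x t :: real
      using that by (simp add: divide_inverse[symmetric])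
    \<comment> \<open>Removing \<open>times_divide_eq_left\<close> keeps the products in the form
      \<open>x * inverse t\<close>, to which the equivalence just shown applies.\<close>
    then show ?thesis
      using N that by (simp add: ball_conj_distrib del: times_divide_eq_left)
  qed
  have ratio: "(a1 \<gamma> \<rho> * par_c1 S
        + (a2 \<gamma> \<rho> * par_c2 S * T2\<^sup>2 + a3 \<gamma> \<rho> * par_c3 S / B + par_Cmax S * X0)
            * (\<Sum>n\<in>{1..par_N S}. K n)
        + a3 \<gamma> \<rho> * par_c4 S * (\<Sum>n\<in>{1..par_N S}. par_q S n * (K n)\<^sup>2))
     / ((par_Cmax S + a2 \<gamma> \<rho> * par_c2 S * T2\<^sup>2 * X0 ^ 3 + a3 \<gamma> \<rho> * par_c3 S * X0\<^sup>2 / B)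
            * (\<Sum>n\<in>{1..par_N S}. K n)
        + a3 \<gamma> \<rho> * par_c4 S * X0\<^sup>2 * (\<Sum>n\<in>{1..par_N S}. par_q S n * (K n)\<^sup>2)) \<le> 1
     \<longleftrightarrow> relaxed_C T2 \<le> par_Cmax S"
    if "X0 = \<rho> powr K 0"
    using ratio_constraint_iff[of X0 "\<Sum>n\<in>{1..par_N S}. K n" "par_Cmax S" "a2 \<gamma> \<rho> * par_c2 S * T2\<^sup>2"
        "a3 \<gamma> \<rho> * par_c3 S / B"
        "a3 \<gamma> \<rho> * par_c4 S * (\<Sum>n\<in>{1..par_N S}. par_q S n * (K n)\<^sup>2)" "a1 \<gamma> \<rho> * par_c1 S"]
      that s q S B \<rho> powr_less_one coefficients_pos
    by (simp add: relaxed_C_def positive_params_def mult_ac)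
  \<comment> \<open>From right to left, \<open>X0 < 1\<close> holds because \<open>K 0 > 0\<close>
    and \<open>\<rho> < 1\<close>.\<close>
  have X0: "0 < X0 \<and> X0 * ln (1 / X0) \<le> X0 * K 0 * ln (1 / \<rho>) \<and>
      K 0 * ln (1 / \<rho>) \<le> ln (1 / X0) \<and> X0 < 1 \<longleftrightarrow> X0 = \<rho> powr K 0"
    using log_constraints_iff_eq_powr[of X0 \<rho> "K 0"] powr_less_one \<rho> by auto
  show ?thesis
    unfolding feasible_P'_def prod.case relaxed_T_def[symmetric]
    using K B X0 maxima ratio by argo
qed

text \<open>From left to right, the two maxima and \<open>\<rho> powr K 0\<close> serve as
  \<open>T1\<close>, \<open>T2\<close> and \<open>X0\<close>. Conversely, monotonicity allows
  \<open>T1\<close> and \<open>T2\<close> to be lowered to the maxima.\<close>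

lemma feasible_P_iff: "feasible_P S \<gamma> \<rho> (K, B) \<longleftrightarrow> (\<exists>T1 T2 X0. feasible_P' S \<gamma> \<rho> (K, B, T1, T2, X0))"
proof -
  let ?m1 = "MAX n\<in>{1..par_N S}. par_C S n / par_F S n * K n" and ?m2 = "MAX n\<in>{1..par_N S}. K n"
  have N: "{1..par_N S} \<noteq> {}"
    using S by (simp add: positive_params_def)
  \<comment> \<open>The maxima qualify as \<open>T1\<close> and \<open>T2\<close> only if they are
    positive; the entry at index 1 shows this.\<close>
  have pos: "0 < ?m1" "0 < ?m2"
    using N S K_pos by (auto simp: Max_gr_iff positive_params_def intro!: bexI[of _ 1])
  show ?thesis
    unfolding feasible_P'_iff
    using K B pos relaxed_T_mono relaxed_C_mono[of ?m2]
    by (auto simp: feasible_P_def T_cost_le_iff C_error_eq intro: order_trans)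
qed

end

lemma feasible_P_iff_ex_feasible_P':
  assumes "positive_params S" "0 < \<gamma>" "0 < \<rho>" "\<rho> < 1"
  shows "feasible_P S \<gamma> \<rho> (K, B) \<longleftrightarrow> (\<exists>T1 T2 X0. feasible_P' S \<gamma> \<rho> (K, B, T1, T2, X0))"
proof (cases "K \<in> pos_tuples S \<and> 0 < B")
  case True
  then show ?thesis
    using feasible_P_iff assms by blast
next
  case False
  then show ?thesis
    by (auto simp: feasible_P_def feasible_P'_def)
qed

theorem theorem4:
  fixes S :: params and \<gamma> \<rho> :: real
    and K :: "nat \<Rightarrow> real" and B T1 T2 X0 :: real
  assumes "positive_params S"
    and "0 < \<gamma>" and "\<gamma> \<le> 1 / par_L S"
    and "0 < \<rho>" and "\<rho> < 1"
    and "optimal_P' S \<gamma> \<rho> (K, B, T1, T2, X0)"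
  shows "optimal_P S \<gamma> \<rho> (K, B)"
  \<comment> \<open>A feasible point of (P) with smaller \<open>E_cost\<close> would lift to a
    feasible point of (P') with the same cost, contradicting optimality there.\<close>
  using assms(6) feasible_P_iff_ex_feasible_P'[OF assms(1,2,4,5)]
  unfolding optimal_P_def optimal_P'_def is_arg_min_def by fastforce

end
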